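(* Let $R$ be a ring, let $M$ be a Euclidean $R$-module and let $a_1,\ldots,a_n\in M$. Then for an element $l\in M$ the following statements are equivalent: (1) $l=\mathrm{lcm}(a_1,\ldots,a_n)$, i.e. $l$ is a least common multiple of $a_1,\ldots,a_n$. (2) For each $i=1,\ldots,n$, $l=\alpha_ia_i$ for some $\alpha_i\in R$, and if an element $l'\in M$ satisfies the same condition (i.e. $l'=\alpha_i'a_i$ for some $\alpha_i'\in R$, for each $i$) then $l'=\alpha l$ for some $\alpha\in R$.
   Context: Rings are unital and modules are left modules. A poset is Artinian if every descending chain in it stabilizes. An $R$-module $M$ is a Euclidean module if there is a function $d_M:M\setminus\{0\}\to P$ to a poset $(P,\ge)$ such that the poset $\mathrm{im}(d_M)$ is Artinian and, for any nonzero $u,v\in M$, there are $q\in R$ and $r\in M$ with $u=qv+r$ and either $r=0$ or $d_M(r)<d_M(v)$. Every submodule of a Euclidean module is cyclic. A least common multiple $\mathrm{lcm}(a_1,\ldots,a_n)$ of $a_1,\ldots,a_n\in M$ is any generator of the cyclic submodule $\bigcap_{i=1}^nRa_i$; it is in general not unique, and "$l=\mathrm{lcm}(a_1,\ldots,a_n)$" means that $l$ is such a generator. *)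

theory Defs
  imports "HOL-Algebra.Module" "HOL-Library.FuncSet"
begin

text \<open>
  The locale \<^locale>\<open>module\<close> requires a commutative base ring; the following has the same
  axioms over an arbitrary unital ring.
\<close>

locale left_module = R?: ring R + M?: abelian_group M
  for R :: "('r, 'a) ring_scheme" (structure) and M :: "('r, 'm, 'b) module_scheme" (structure) +
  assumes smult_closed [simp, intro]:
      "\<lbrakk>r \<in> carrier R; x \<in> carrier M\<rbrakk> \<Longrightarrow> r \<odot>\<^bsub>M\<^esub> x \<in> carrier M"
    and smult_l_distr:
      "\<lbrakk>r \<in> carrier R; s \<in> carrier R; x \<in> carrier M\<rbrakk> \<Longrightarrow>
        (r \<oplus>\<^bsub>R\<^esub> s) \<odot>\<^bsub>M\<^esub> x = r \<odot>\<^bsub>M\<^esub> x \<oplus>\<^bsub>M\<^esub> s \<odot>\<^bsub>M\<^esub> x"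
    and smult_r_distr:
      "\<lbrakk>r \<in> carrier R; x \<in> carrier M; y \<in> carrier M\<rbrakk> \<Longrightarrow>
        r \<odot>\<^bsub>M\<^esub> (x \<oplus>\<^bsub>M\<^esub> y) = r \<odot>\<^bsub>M\<^esub> x \<oplus>\<^bsub>M\<^esub> r \<odot>\<^bsub>M\<^esub> y"
    and smult_assoc1:
      "\<lbrakk>r \<in> carrier R; s \<in> carrier R; x \<in> carrier M\<rbrakk> \<Longrightarrow>
        (r \<otimes>\<^bsub>R\<^esub> s) \<odot>\<^bsub>M\<^esub> x = r \<odot>\<^bsub>M\<^esub> (s \<odot>\<^bsub>M\<^esub> x)"
    and smult_one [simp]:
      "x \<in> carrier M \<Longrightarrow> \<one>\<^bsub>R\<^esub> \<odot>\<^bsub>M\<^esub> x = x"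

definition artinian_poset :: "('p, 'c) gorder_scheme \<Rightarrow> bool" where
  "artinian_poset P \<longleftrightarrow> partial_order P \<and>
     (\<forall>f :: nat \<Rightarrow> 'p. (\<forall>i. f i \<in> carrier P) \<and> (\<forall>i. f (Suc i) \<sqsubseteq>\<^bsub>P\<^esub> f i)
        \<longrightarrow> (\<exists>N. \<forall>k\<ge>N. f k = f N))"

text \<open>
  Only the image of \<^term>\<open>d\<close>, with the order induced from \<^term>\<open>P\<close>, has to be Artinian.
\<close>

definition euclidean_function ::
    "('r, 'a) ring_scheme \<Rightarrow> ('r, 'm, 'b) module_scheme \<Rightarrow> ('p, 'c) gorder_scheme \<Rightarrow> ('m \<Rightarrow> 'p) \<Rightarrow> bool"
  where
  "euclidean_function R M P d \<longleftrightarrow>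
     d \<in> carrier M - {\<zero>\<^bsub>M\<^esub>} \<rightarrow> carrier P \<and>
     artinian_poset (P\<lparr>carrier := d ` (carrier M - {\<zero>\<^bsub>M\<^esub>})\<rparr>) \<and>
     (\<forall>u \<in> carrier M - {\<zero>\<^bsub>M\<^esub>}. \<forall>v \<in> carrier M - {\<zero>\<^bsub>M\<^esub>}.
        \<exists>q \<in> carrier R. \<exists>r \<in> carrier M.
          u = q \<odot>\<^bsub>M\<^esub> v \<oplus>\<^bsub>M\<^esub> r \<and> (r = \<zero>\<^bsub>M\<^esub> \<or> d r \<sqsubset>\<^bsub>P\<^esub> d v))"

text \<open>
  HOL cannot quantify existentially over the type in which the poset lives, so that type is a
  parameter; the poset itself is any partial order whose carrier is a subset of it. A theorem
  assuming \<^term>\<open>euclidean_module TYPE('p) R M\<close> for a type variable \<^typ>\<open>'p\<close> covers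
  all posets.
\<close>

definition euclidean_module ::
    "'p itself \<Rightarrow> ('r, 'a) ring_scheme \<Rightarrow> ('r, 'm, 'b) module_scheme \<Rightarrow> bool" where
  "euclidean_module _ R M \<longleftrightarrow> left_module R M \<and>
     (\<exists>(P :: 'p gorder) d. partial_order P \<and> euclidean_function R M P d)"

definition cyclic_submodule ::
    "('r, 'a) ring_scheme \<Rightarrow> ('r, 'm, 'b) module_scheme \<Rightarrow> 'm \<Rightarrow> 'm set" where
  "cyclic_submodule R M x = {r \<odot>\<^bsub>M\<^esub> x | r. r \<in> carrier R}"

text \<open>
  Intersecting with the carrier only matters for an empty family, whose intersection is the
  whole module.
\<close>

definition is_lcm ::
    "('r, 'a) ring_scheme \<Rightarrow> ('r, 'm, 'b) module_scheme \<Rightarrow> nat \<Rightarrow> (nat \<Rightarrow> 'm) \<Rightarrow> 'm \<Rightarrow> bool" where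
  "is_lcm R M n a l \<longleftrightarrow> l \<in> carrier M \<and>
     cyclic_submodule R M l = carrier M \<inter> (\<Inter>i\<in>{1..n}. cyclic_submodule R M (a i))"

end

theory Submission
  imports Defs
begin

text \<open>Divisibility in a module is inclusion of cyclic submodules: \<open>x\<close> is a
  multiple of \<open>y\<close> iff Rx is contained in Ry
  (\<open>cyclic_submodule_subset_iff\<close>). So being a common multiple of the a_i means that Rl
  lies in the intersection of the R a_i, and dividing every common multiple means that this
  intersection lies in Rl. Condition (2) is thus the equality defining an lcm, split into its two
  inclusions (\<open>is_lcm_iff\<close>).\<close>

context left_module
begin

text \<open>The unit puts \<open>x\<close> into Rx, which gives one direction; the other is
  associativity, r(sy) = (rs)y.\<close>

lemma cyclic_submodule_subset_iff:
  assumes "x \<in> carrier M" "y \<in> carrier M"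
  shows "cyclic_submodule R M x \<subseteq> cyclic_submodule R M y \<longleftrightarrow> x \<in> cyclic_submodule R M y"
proof
  assume "cyclic_submodule R M x \<subseteq> cyclic_submodule R M y"
  moreover have "x \<in> cyclic_submodule R M x"
    using assms by (force simp: cyclic_submodule_def intro: exI[of _ "\<one>\<^bsub>R\<^esub>"])
  ultimately show "x \<in> cyclic_submodule R M y" ..
next
  assume "x \<in> cyclic_submodule R M y"
  then obtain s where "s \<in> carrier R" "x = s \<odot>\<^bsub>M\<^esub> y"
    by (auto simp: cyclic_submodule_def)
  with assms show "cyclic_submodule R M x \<subseteq> cyclic_submodule R M y"
    by (auto simp: cyclic_submodule_def smult_assoc1[symmetric])
qed

lemma cyclic_submodule_subset_carrier:
  "x \<in> carrier M \<Longrightarrow> cyclic_submodule R M x \<subseteq> carrier M"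
  by (auto simp: cyclic_submodule_def)

lemma is_lcm_iff:
  assumes "\<forall>i\<in>{1..n}. a i \<in> carrier M" "l \<in> carrier M"
  shows "is_lcm R M n a l \<longleftrightarrow>
    (\<forall>i\<in>{1..n}. l \<in> cyclic_submodule R M (a i)) \<and>
    (\<forall>l'\<in>carrier M. (\<forall>i\<in>{1..n}. l' \<in> cyclic_submodule R M (a i)) \<longrightarrow>
       l' \<in> cyclic_submodule R M l)"
proof -
  \<comment> \<open>Only this inclusion needs the module axioms. The reverse one, read elementwise,
    is already the second conjunct; the factor \<open>carrier M\<close> matches its bound on
    \<open>l'\<close> and covers n = 0.\<close>
  have "(\<forall>i\<in>{1..n}. l \<in> cyclic_submodule R M (a i)) \<longleftrightarrow>
      cyclic_submodule R M l \<subseteq> carrier M \<inter> (\<Inter>i\<in>{1..n}. cyclic_submodule R M (a i))"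
    using assms by (simp add: cyclic_submodule_subset_iff cyclic_submodule_subset_carrier
      le_INF_iff)
  then show ?thesis
    using assms(2) unfolding is_lcm_def by blast
qed

end

theorem proposition2p13:
  fixes R :: "('r, 'a) ring_scheme" and M :: "('r, 'm, 'b) module_scheme"
    and a :: "nat \<Rightarrow> 'm" and n :: nat and l :: 'm
  assumes "ring R"
    and "euclidean_module TYPE('p) R M"
    and "\<forall>i\<in>{1..n}. a i \<in> carrier M"
    and "l \<in> carrier M"
  shows "is_lcm R M n a l \<longleftrightarrow>
    (\<forall>i\<in>{1..n}. \<exists>\<alpha>\<in>carrier R. l = \<alpha> \<odot>\<^bsub>M\<^esub> a i) \<and>
    (\<forall>l'\<in>carrier M. (\<forall>i\<in>{1..n}. \<exists>\<alpha>'\<in>carrier R. l' = \<alpha>' \<odot>\<^bsub>M\<^esub> a i) \<longrightarrow>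
       (\<exists>\<alpha>\<in>carrier R. l' = \<alpha> \<odot>\<^bsub>M\<^esub> l))"
proof -
  have "left_module R M"
    using assms(2) by (simp add: euclidean_module_def)
  \<comment> \<open>Membership in R a_i unfolds to the existence of a coefficient;
    \<open>conj_commute\<close> reconciles the order of conjuncts in the set comprehension with that
    in \<open>Bex\<close>.\<close>
  from left_module.is_lcm_iff[OF this assms(3,4)] show ?thesis
    by (auto simp: cyclic_submodule_def Bex_def conj_commute)
qed

end
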